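(* The prescription assigning (a) an object $\mathcal{H}_E[l]=\mathcal{H}_1{}^{\otimes l}$ of $\mathsf{HH}$ for every $l\in\mathbb{N}$ and (b) a morphism $\mathcal{H}_Ef:\mathcal{H}_E[l]\to\mathcal{H}_E[m]$ given by $\mathcal{H}_Ef\,|x\rangle=|Ef(x)\rangle$ with $x\in E[l]$, for every $l,m\in\mathbb{N}$ and $f\in\mathrm{Hom}_\Omega([l],[m])$, specifies a functor $\mathcal{H}_E:\Omega\rightarrow\mathsf{HH}$ injective on objects and morphisms. Therefore, there exists an $\Omega$ category $\mathcal{H}_E\Omega$ having the functor $\mathcal{H}_E$ with the target category $\mathsf{HH}$ restricted to $\mathcal{H}_E\Omega$ as its stalk isofunctor. Further, $\mathcal{H}_E\Omega$ is a non monoidal subcategory of $\mathsf{HH}$.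
   Context: $\mathsf{HH}$ denotes the category of finite dimensional Hilbert spaces and linear maps. $\mathsf{R}$ is an additive finite commutative monoid with $\mathsf{R}\neq0$, and $\mathcal{H}_1$ is a Hilbert space with a distinguished orthonormal basis $|z\rangle_1$, $z\in\mathsf{R}$; $\mathcal{H}_E[0]=\mathbb{C}$, and for $x\in\mathsf{R}^l$, $|x\rangle=|x_1\rangle_1\otimes\cdots\otimes|x_l\rangle_1$ is the induced orthonormal basis of $\mathcal{H}_1{}^{\otimes l}$. $\Omega$ is the category of finite ordinals $[l]=\{0,\dots,l-1\}$ and all functions, strict monoidal with $[l]\smile[m]=[l+m]$, $f\smile g(i)=f(i)$ for $i\in[l]$ and $g(i-l)+p$ for $i\in[m]+l$, unit $[0]$. $E[l]=\mathsf{R}^l$ and $Ef(x)_s=\sum_{r\in[l],f(r)=s}x_r$ for $f:[l]\to[m]$ (a functor $\Omega\to$ finite sets, injective on objects and morphisms). An $\Omega$ category is a Pro category $D\Omega$ with a strict monoidal isofunctor (stalk isofunctor) $D:\Omega\to D\Omega$; for $D$ injective on objects and morphisms, $D\Omega$ has objects $D[l]$, morphisms $Df$, composition $D(g\circ f)$, identities $D\,\mathrm{id}_{[l]}$, monoidal products $D[l]\smile D[m]=D([l]\smile[m])$, $Df\smile Dg=D(f\smile g)$, unit $D[0]$. *)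

theory Defs
  imports Complex_Main "HOL-Library.FuncSet"
begin

(* Omega: objects [l] = {0..<l} (represented by l :: nat); morphisms [l] -> [m] are
   extensional functions {..<l} ->E {..<m}. *)
definition Omega_hom :: "nat \<Rightarrow> nat \<Rightarrow> (nat \<Rightarrow> nat) set" where
  "Omega_hom l m = ({..<l} \<rightarrow>\<^sub>E {..<m})"

definition Omega_comp :: "nat \<Rightarrow> (nat \<Rightarrow> nat) \<Rightarrow> (nat \<Rightarrow> nat) \<Rightarrow> (nat \<Rightarrow> nat)" where
  "Omega_comp l g f = compose {..<l} g f"

definition Omega_id :: "nat \<Rightarrow> (nat \<Rightarrow> nat)" where
  "Omega_id l = restrict (\<lambda>i. i) {..<l}"

(* E[l] = R^l, as lists of length l *)
definition Evec :: "nat \<Rightarrow> 'r list set" where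
  "Evec l = {x. length x = l}"

definition Emap :: "nat \<Rightarrow> nat \<Rightarrow> (nat \<Rightarrow> nat) \<Rightarrow> 'r::comm_monoid_add list \<Rightarrow> 'r list" where
  "Emap l m f x = map (\<lambda>s. \<Sum>r\<in>{r. r < l \<and> f r = s}. x ! r) [0..<m]"

(* H_E[l] = H_1^{\<otimes> l}: complex functions on R^l (finite, since R is finite), i.e.
   C^(R^l) with orthonormal basis |x>, x in R^l, and standard inner product. *)
definition HE_obj :: "nat \<Rightarrow> ('r list \<Rightarrow> complex) set" where
  "HE_obj l = {v. \<forall>x. length x \<noteq> l \<longrightarrow> v x = 0}"

definition ket :: "'r list \<Rightarrow> ('r list \<Rightarrow> complex)" where
  "ket x = (\<lambda>y. if y = x then 1 else 0)"

definition HE_inner :: "nat \<Rightarrow> ('r::finite list \<Rightarrow> complex) \<Rightarrow> ('r list \<Rightarrow> complex) \<Rightarrow> complex" where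
  "HE_inner l v w = (\<Sum>x\<in>Evec l. cnj (v x) * w x)"

(* H_E f : the linear extension of |x> |-> |E f x> *)
definition HE_mor :: "nat \<Rightarrow> nat \<Rightarrow> (nat \<Rightarrow> nat) \<Rightarrow> ('r::{finite,comm_monoid_add} list \<Rightarrow> complex)
                        \<Rightarrow> ('r list \<Rightarrow> complex)" where
  "HE_mor l m f v = (\<lambda>y. if length y = m then (\<Sum>x\<in>{x \<in> Evec l. Emap l m f x = y}. v x) else 0)"

(* Morphisms of HH as triples (domain, codomain, map restricted to domain) *)
type_synonym 'r hmor = "('r list \<Rightarrow> complex) set \<times> ('r list \<Rightarrow> complex) set \<times> (('r list \<Rightarrow> complex) \<Rightarrow> ('r list \<Rightarrow> complex))"

definition HH_comp :: "'r hmor \<Rightarrow> 'r hmor \<Rightarrow> 'r hmor" where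
  "HH_comp \<psi> \<phi> = (fst \<phi>, fst (snd \<psi>), restrict (snd (snd \<psi>) \<circ> snd (snd \<phi>)) (fst \<phi>))"

definition HH_id :: "('r list \<Rightarrow> complex) set \<Rightarrow> 'r hmor" where
  "HH_id A = (A, A, restrict (\<lambda>v. v) A)"

definition clinear_on :: "('a \<Rightarrow> complex) set \<Rightarrow> (('a \<Rightarrow> complex) \<Rightarrow> ('b \<Rightarrow> complex)) \<Rightarrow> bool" where
  "clinear_on A F \<longleftrightarrow> (\<forall>v\<in>A. \<forall>w\<in>A. \<forall>c::complex.
       F (\<lambda>x. v x + w x) = (\<lambda>y. F v y + F w y) \<and> F (\<lambda>x. c * v x) = (\<lambda>y. c * F v y))"

definition HE_fun :: "nat \<Rightarrow> nat \<Rightarrow> (nat \<Rightarrow> nat) \<Rightarrow> ('r::{finite,comm_monoid_add}) hmor" where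
  "HE_fun l m f = (HE_obj l, HE_obj m, restrict (HE_mor l m f) (HE_obj l))"

end

theory Submission
  imports Defs
begin

(* E is a functor from Omega to finite sets: E f adds up the coordinates of x along the fibres of f,
   and summing first along the fibres of f and then along those of g is summing along the fibres
   of g o f. H_E f is the pushforward of functions along E f, i.e. the linear extension of
   |x> |-> |E f x>, so functoriality of E carries over to H_E. H_E is injective on objects because
   the kets in H_E[l] are exactly those of length l, and on morphisms because, for z <> 0, E f sends the
   vector with single entry z at position r to the vector with single entry z at position f r.
   The image is closed under composition in HH because composable images have composable
   preimages, by injectivity on objects. *)

lemma finite_Evec [simp]: "finite (Evec l :: 'r::finite list set)"
  using finite_lists_length_eq[of "UNIV :: 'r set" l] by (simp add: Evec_def)

lemma length_Emap [simp]: "length (Emap l m f x) = m"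
  by (simp add: Emap_def)

lemma Emap_in_Evec [simp]: "Emap l m f x \<in> Evec m"
  by (simp add: Evec_def)

lemma nth_Emap: "s < m \<Longrightarrow> Emap l m f x ! s = (\<Sum>r\<in>{r. r < l \<and> f r = s}. x ! r)"
  by (simp add: Emap_def)

lemma Omega_comp_in_Omega_hom:
  "f \<in> Omega_hom l m \<Longrightarrow> g \<in> Omega_hom m p \<Longrightarrow> Omega_comp l g f \<in> Omega_hom l p"
  by (auto simp: Omega_hom_def Omega_comp_def compose_def PiE_iff)

lemma Omega_id_in_Omega_hom: "Omega_id l \<in> Omega_hom l l"
  by (auto simp: Omega_hom_def Omega_id_def)

lemma Emap_Omega_comp:
  assumes f: "f \<in> Omega_hom l m" and g: "g \<in> Omega_hom m p"
  shows "Emap m p g (Emap l m f x) = Emap l p (Omega_comp l g f) x"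
proof (rule nth_equalityI)
  fix s assume "s < length (Emap m p g (Emap l m f x))"
  then have s: "s < p" by simp
  have f_less: "r < l \<Longrightarrow> f r < m" for r
    using f by (auto simp: Omega_hom_def)
  have "Emap m p g (Emap l m f x) ! s
      = (\<Sum>t\<in>{t. t < m \<and> g t = s}. \<Sum>r\<in>{r. r < l \<and> f r = t}. x ! r)"
    using s by (simp add: nth_Emap)
  also have "\<dots> = (\<Sum>t\<in>{t. t < m \<and> g t = s}.
                     \<Sum>r\<in>{r \<in> {r. r < l \<and> g (f r) = s}. f r = t}. x ! r)"
    by (rule sum.cong) (auto intro!: sum.cong)
  also have "\<dots> = (\<Sum>r\<in>{r. r < l \<and> g (f r) = s}. x ! r)"
    by (rule sum.group) (auto simp: f_less)
  also have "\<dots> = Emap l p (Omega_comp l g f) x ! s"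
    using s by (simp add: nth_Emap Omega_comp_def compose_def) (rule sum.cong, auto)
  finally show "Emap m p g (Emap l m f x) ! s = Emap l p (Omega_comp l g f) x ! s" .
qed simp

lemma Emap_Omega_id: "length x = l \<Longrightarrow> Emap l l (Omega_id l) x = x"
proof (rule nth_equalityI)
  fix s assume "length x = l" "s < length (Emap l l (Omega_id l) x)"
  moreover from this have "{r. r < l \<and> Omega_id l r = s} = {s}"
    by (auto simp: Omega_id_def)
  ultimately show "Emap l l (Omega_id l) x ! s = x ! s"
    by (simp add: nth_Emap)
qed simp

lemma Emap_single:
  assumes f: "f \<in> Omega_hom l m" and r: "r < l"
  shows "Emap l m f ((replicate l 0)[r := z]) = (replicate m 0)[f r := z]"
proof (rule nth_equalityI)
  fix s assume "s < length (Emap l m f ((replicate l 0)[r := z]))"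
  then have s: "s < m" by simp
  have "(replicate l 0)[r := z] ! r' = (if r' = r then z else 0)" if "r' < l" for r'
    using that r by (simp add: nth_list_update)
  then have "Emap l m f ((replicate l 0)[r := z]) ! s
      = (\<Sum>r'\<in>{r'. r' < l \<and> f r' = s}. if r' = r then z else 0)"
    using s by (simp add: nth_Emap)
  also have "\<dots> = (replicate m 0)[f r := z] ! s"
    using r s f by (subst sum.delta) (auto simp: nth_list_update Omega_hom_def)
  finally show "Emap l m f ((replicate l 0)[r := z]) ! s = (replicate m 0)[f r := z] ! s" .
qed simp

lemma Emap_inject:
  fixes z :: "'r::comm_monoid_add"
  assumes f: "f \<in> Omega_hom l m" and f': "f' \<in> Omega_hom l m" and z: "z \<noteq> 0"
    and Emap_eq: "\<And>x :: 'r list. x \<in> Evec l \<Longrightarrow> Emap l m f x = Emap l m f' x"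
  shows "f = f'"
proof (rule extensionalityI[of f "{..<l}" f'])
  show "f \<in> extensional {..<l}" "f' \<in> extensional {..<l}"
    using f f' by (auto simp: Omega_hom_def PiE_iff)
next
  fix r assume "r \<in> {..<l}"
  then have r: "r < l" by simp
  with f have fr: "f r < m" by (auto simp: Omega_hom_def)
  have "(replicate m 0)[f r := z] = Emap l m f ((replicate l 0)[r := z])"
    by (rule Emap_single[OF f r, symmetric])
  also have "\<dots> = Emap l m f' ((replicate l 0)[r := z])"
    by (rule Emap_eq) (simp add: Evec_def)
  also have "\<dots> = (replicate m 0)[f' r := z]"
    by (rule Emap_single[OF f' r])
  finally have single_eq: "(replicate m 0)[f r := z] ! f r = (replicate m 0)[f' r := z] ! f r"
    by simp
  show "f r = f' r"
  proof (rule ccontr)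
    assume "f r \<noteq> f' r"
    with fr have "(replicate m 0)[f r := z] ! f r = z" "(replicate m 0)[f' r := z] ! f r = 0"
      by simp_all
    with single_eq z show False by simp
  qed
qed

lemma ket_in_HE_obj: "ket x \<in> HE_obj (length x)"
  by (auto simp: ket_def HE_obj_def)

lemma ket_inject: "ket x = ket y \<Longrightarrow> x = y"
  by (metis ket_def zero_neq_one)

lemma inj_HE_obj: "inj (HE_obj :: nat \<Rightarrow> ('r list \<Rightarrow> complex) set)"
proof (rule injI)
  fix l l' assume "(HE_obj l :: ('r list \<Rightarrow> complex) set) = HE_obj l'"
  with ket_in_HE_obj[of "replicate l (undefined :: 'r)"]
  have "ket (replicate l (undefined :: 'r)) \<in> HE_obj l'" by simp
  then show "l = l'" by (auto simp: HE_obj_def ket_def split: if_splits)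
qed

lemma HE_mor_in_HE_obj: "HE_mor l m f v \<in> HE_obj m"
  by (simp add: HE_mor_def HE_obj_def)

lemma clinear_on_HE_mor: "clinear_on A (HE_mor l m f)"
  by (auto simp: clinear_on_def HE_mor_def sum.distrib sum_distrib_left)

lemma HE_mor_ket:
  fixes x :: "'r::{finite,comm_monoid_add} list"
  assumes "x \<in> Evec l"
  shows "HE_mor l m f (ket x) = ket (Emap l m f x)"
proof
  fix y :: "'r list"
  have "(\<Sum>x'\<in>{x' \<in> Evec l. Emap l m f x' = y}. ket x x')
      = (if x \<in> {x' \<in> Evec l. Emap l m f x' = y} then 1 else 0)"
    unfolding ket_def by (subst sum.delta) auto
  then show "HE_mor l m f (ket x) y = ket (Emap l m f x) y"
    using assms by (auto simp: HE_mor_def ket_def)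
qed

lemma HE_mor_Omega_comp:
  fixes v :: "'r::{finite,comm_monoid_add} list \<Rightarrow> complex"
  assumes f: "f \<in> Omega_hom l m" and g: "g \<in> Omega_hom m p"
  shows "HE_mor m p g (HE_mor l m f v) = HE_mor l p (Omega_comp l g f) v"
proof
  fix y :: "'r list"
  note Emap_gf = Emap_Omega_comp[OF f g, symmetric]
  show "HE_mor m p g (HE_mor l m f v) y = HE_mor l p (Omega_comp l g f) v y"
  proof (cases "length y = p")
    case True
    have "HE_mor m p g (HE_mor l m f v) y
        = (\<Sum>z\<in>{z \<in> Evec m. Emap m p g z = y}. \<Sum>x\<in>{x \<in> Evec l. Emap l m f x = z}. v x)"
      using True by (simp add: HE_mor_def Evec_def)
    also have "\<dots> = (\<Sum>z\<in>{z \<in> Evec m. Emap m p g z = y}.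
                       \<Sum>x\<in>{x \<in> {x \<in> Evec l. Emap l p (Omega_comp l g f) x = y}. Emap l m f x = z}. v x)"
      by (rule sum.cong) (auto simp: Emap_gf intro!: sum.cong)
    also have "\<dots> = (\<Sum>x\<in>{x \<in> Evec l. Emap l p (Omega_comp l g f) x = y}. v x)"
      by (rule sum.group) (auto simp: Emap_gf)
    finally show ?thesis
      using True by (simp add: HE_mor_def)
  qed (simp add: HE_mor_def)
qed

lemma HE_mor_Omega_id:
  fixes v :: "'r::{finite,comm_monoid_add} list \<Rightarrow> complex"
  assumes v: "v \<in> HE_obj l"
  shows "HE_mor l l (Omega_id l) v = v"
proof
  fix y :: "'r list"
  show "HE_mor l l (Omega_id l) v y = v y"
  proof (cases "length y = l")
    case True
    then have "{x \<in> Evec l. Emap l l (Omega_id l) x = y} = {y}"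
      by (auto simp: Evec_def Emap_Omega_id)
    with True show ?thesis by (simp add: HE_mor_def)
  qed (use v in \<open>simp add: HE_mor_def HE_obj_def\<close>)
qed

lemma HE_fun_Omega_comp:
  assumes "f \<in> Omega_hom l m" and "g \<in> Omega_hom m p"
  shows "(HE_fun l p (Omega_comp l g f) :: 'r::{finite,comm_monoid_add} hmor)
       = HH_comp (HE_fun m p g) (HE_fun l m f)"
  unfolding HE_fun_def HH_comp_def
  by (auto simp: HE_mor_in_HE_obj HE_mor_Omega_comp[OF assms] intro!: restrict_ext)

lemma HE_fun_Omega_id:
  "(HE_fun l l (Omega_id l) :: 'r::{finite,comm_monoid_add} hmor) = HH_id (HE_obj l)"
  unfolding HE_fun_def HH_id_def by (auto simp: HE_mor_Omega_id intro!: restrict_ext)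

lemma HE_fun_inject:
  fixes z :: "'r::{finite,comm_monoid_add}"
  assumes z: "z \<noteq> 0" and f: "f \<in> Omega_hom l m" and f': "f' \<in> Omega_hom l' m'"
    and HE_eq: "(HE_fun l m f :: 'r hmor) = HE_fun l' m' f'"
  shows "l = l' \<and> m = m' \<and> f = f'"
proof -
  have l: "l = l'" and m: "m = m'"
    using HE_eq inj_HE_obj[where 'r = 'r] by (auto simp: HE_fun_def inj_def)
  have restrict_eq: "restrict (HE_mor l m f) (HE_obj l) = (restrict (HE_mor l m f') (HE_obj l)
          :: ('r list \<Rightarrow> complex) \<Rightarrow> _)"
    using HE_eq by (simp add: HE_fun_def l m)
  have "HE_mor l m f (ket x) = HE_mor l m f' (ket x)" if "x \<in> Evec l" for x :: "'r list"
    using that fun_cong[OF restrict_eq, of "ket x"] ket_in_HE_obj[of x] by (simp add: Evec_def)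
  then have "ket (Emap l m f x) = ket (Emap l m f' x)" if "x \<in> Evec l" for x :: "'r list"
    using that by (simp add: HE_mor_ket)
  then have "f = f'"
    using Emap_inject[OF f _ z] f' by (simp add: l m ket_inject)
  with l m show ?thesis by simp
qed

lemma HH_comp_HE_fun_in_image:
  assumes "\<phi> \<in> {HE_fun l m f | l m f. f \<in> Omega_hom l m}"
    and "\<psi> \<in> {HE_fun l m f | l m f. f \<in> Omega_hom l m}"
    and composable: "fst (snd \<phi>) = fst \<psi>"
  shows "(HH_comp \<psi> \<phi> :: 'r::{finite,comm_monoid_add} hmor)
           \<in> {HE_fun l m f | l m f. f \<in> Omega_hom l m}"
proof -
  obtain l m f where \<phi>: "\<phi> = HE_fun l m f" and f: "f \<in> Omega_hom l m"
    using assms(1) by blast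
  obtain m' p g where \<psi>: "\<psi> = HE_fun m' p g" and g: "g \<in> Omega_hom m' p"
    using assms(2) by blast
  have "m = m'"
    using composable inj_HE_obj[where 'r = 'r] by (simp add: \<phi> \<psi> HE_fun_def inj_eq)
  with f g have "HH_comp \<psi> \<phi> = HE_fun l p (Omega_comp l g f)"
    by (simp add: \<phi> \<psi> HE_fun_Omega_comp)
  with f g \<open>m = m'\<close> show ?thesis
    using Omega_comp_in_Omega_hom by blast
qed

theorem proposition4p6:
  assumes nontriv: "\<exists>z::'r::{finite,comm_monoid_add}. z \<noteq> 0"
  shows
    \<comment> \<open>(b) H_E f is a morphism H_E[l] -> H_E[m] of HH with H_E f |x> = |E f x>\<close>
    "(\<forall>l m f. f \<in> Omega_hom l m \<longrightarrow>
        HE_mor l m f ` HE_obj l \<subseteq> (HE_obj m :: ('r list \<Rightarrow> complex) set)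
      \<and> clinear_on (HE_obj l :: ('r list \<Rightarrow> complex) set) (HE_mor l m f)
      \<and> (\<forall>x::'r list. x \<in> Evec l \<longrightarrow> HE_mor l m f (ket x) = ket (Emap l m f x)))
   \<comment> \<open>functoriality: composition\<close>
   \<and> (\<forall>l m p f g. f \<in> Omega_hom l m \<longrightarrow> g \<in> Omega_hom m p \<longrightarrow>
        (HE_fun l p (Omega_comp l g f) :: 'r hmor) = HH_comp (HE_fun m p g) (HE_fun l m f))
   \<comment> \<open>functoriality: identities\<close>
   \<and> (\<forall>l. (HE_fun l l (Omega_id l) :: 'r hmor) = HH_id (HE_obj l))
   \<comment> \<open>injective on objects\<close>
   \<and> inj (HE_obj :: nat \<Rightarrow> ('r list \<Rightarrow> complex) set)
   \<comment> \<open>injective on morphisms\<close>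
   \<and> inj_on (\<lambda>(l, m, f). (HE_fun l m f :: 'r hmor)) {(l, m, f). f \<in> Omega_hom l m}
   \<comment> \<open>the image H_E Omega is a subcategory of HH: closed under composition and identities\<close>
   \<and> (\<forall>\<phi>\<in>{HE_fun l m f | l m f. f \<in> Omega_hom l m}. \<forall>\<psi>\<in>{HE_fun l m f | l m f. f \<in> Omega_hom l m}.
        fst (snd \<phi>) = fst \<psi> \<longrightarrow>
        (HH_comp \<psi> \<phi> :: 'r hmor) \<in> {HE_fun l m f | l m f. f \<in> Omega_hom l m})
   \<and> (\<forall>l. (HH_id (HE_obj l) :: 'r hmor) \<in> {HE_fun l' m f | l' m f. f \<in> Omega_hom l' m})"
proof -
  obtain z :: 'r where "z \<noteq> 0"
    using nontriv by blast
  then have "inj_on (\<lambda>(l, m, f). (HE_fun l m f :: 'r hmor)) {(l, m, f). f \<in> Omega_hom l m}"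
    by (auto intro!: inj_onI dest: HE_fun_inject)
  moreover have "(HH_id (HE_obj l) :: 'r hmor) \<in> {HE_fun l' m f | l' m f. f \<in> Omega_hom l' m}"
    for l
    using HE_fun_Omega_id[of l, where 'r = 'r] Omega_id_in_Omega_hom[of l] by force
  ultimately show ?thesis
    by (intro conjI allI impI ballI image_subsetI HH_comp_HE_fun_in_image)
      (simp_all add: HE_mor_in_HE_obj clinear_on_HE_mor HE_mor_ket
        HE_fun_Omega_comp HE_fun_Omega_id inj_HE_obj)
qed

end
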